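(* Let $\mu$ be a positive finite Borel measure on $(0,1)$. Let $\alpha,\beta$ be real numbers with $\alpha>-1$, $\beta>-1$ and $\beta-\alpha>-1$. Define weights on $\mathbb{N}_0$ by $$\overline{w}_1(m)=\big[(m+1)_{\alpha}\big]^{-1},\qquad \overline{w}_2(m)=\big[(m+\beta-\alpha+1)_{\alpha}\big]^{-1},\qquad m\in\mathbb{N}_0.$$ Then the operator $H_{\mu}^{\alpha,\beta}$ is bounded from $l^\infty_{\overline{w}_1}$ into $l^\infty_{\overline{w}_2}$ if and only if $$\mathcal{C}_{\mu}(\beta,\infty):=\int_{(0,1)}(1-t)^{-\beta-1}\,d\mu(t)<\infty.$$ Moreover, when $H_{\mu}^{\alpha,\beta}:l^\infty_{\overline{w}_1}\to l^\infty_{\overline{w}_2}$ is bounded, its operator norm is $\|H_{\mu}^{\alpha,\beta}\|=\mathcal{C}_{\mu}(\beta,\infty)$.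
   Context: $\mathbb{N}_0=\{0,1,2,\dots\}$ and $\Gamma$ is the Gamma function. For real numbers $\gamma,s$ with $\gamma>-1$ and $\gamma+s>-1$, put $(\gamma+1)_s:=\dfrac{\Gamma(\gamma+s+1)}{\Gamma(\gamma+1)}$ (so e.g. $(m+1)_\alpha=\Gamma(m+\alpha+1)/\Gamma(m+1)$ and $(m+\beta-\alpha+1)_\alpha=\Gamma(m+\beta+1)/\Gamma(m+\beta-\alpha+1)$). For a weight $w:\mathbb{N}_0\to[0,\infty)$, $l^\infty_w$ is the space of complex sequences $a=\{a_n\}_{n=0}^\infty$ with $\|a\|_{\infty,w}=\sup_{n\in\mathbb{N}_0}w(n)|a_n|<\infty$. For $\alpha,\beta>-1$ with $\beta-\alpha>-1$, a positive finite Borel measure $\mu$ on $(0,1)$ and a complex sequence $a=\{a_m\}_{m=0}^\infty$, the generalized Hilbert matrix operator is $$H_{\mu}^{\alpha,\beta}(a)(n):=\sum_{m=0}^{\infty}\int_{(0,1)}\frac{\Gamma(n+m+\beta+1)}{\Gamma(m+\alpha+1)\Gamma(n+\beta-\alpha+1)}\,t^m(1-t)^n a_m\,d\mu(t),\qquad n\in\mathbb{N}_0.$$ Bounded from $X$ into $Y$ means: for every $a\in X$ the series defining $H_\mu^{\alpha,\beta}(a)(n)$ converges for every $n$, and there is a constant $C$ with $\|H_\mu^{\alpha,\beta}(a)\|_Y\le C\|a\|_X$ for all $a\in X$; the norm is the least such $C$. *)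

theory Defs
  imports "HOL-Analysis.Analysis"
begin

text \<open>
  The symbol $(x)_s$ for real \<open>s\<close>, used for \<open>x > 0\<close> and \<open>x + s > 0\<close>. The library constant
  \<open>pochhammer\<close> only covers natural \<open>s\<close>.
\<close>

definition real_pochhammer :: "real \<Rightarrow> real \<Rightarrow> real" where
  "real_pochhammer x s = Gamma (x + s) / Gamma x"

definition linf :: "(nat \<Rightarrow> real) \<Rightarrow> (nat \<Rightarrow> complex) set" where
  "linf w = {a. bdd_above (range (\<lambda>n. w n * cmod (a n)))}"

definition linf_norm :: "(nat \<Rightarrow> real) \<Rightarrow> (nat \<Rightarrow> complex) \<Rightarrow> real" where
  "linf_norm w a = (SUP n. w n * cmod (a n))"

definition hilbert_term ::
  "real measure \<Rightarrow> real \<Rightarrow> real \<Rightarrow> (nat \<Rightarrow> complex) \<Rightarrow> nat \<Rightarrow> nat \<Rightarrow> complex" where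
  "hilbert_term \<mu> \<alpha> \<beta> a n m =
     (LINT t|\<mu>. complex_of_real
        (Gamma (real n + real m + \<beta> + 1) /
           (Gamma (real m + \<alpha> + 1) * Gamma (real n + \<beta> - \<alpha> + 1))
         * t ^ m * (1 - t) ^ n) * a m)"

text \<open>Only meaningful where the series converges; convergence is part of \<open>hilbert_bounded\<close>.\<close>

definition hilbert_op ::
  "real measure \<Rightarrow> real \<Rightarrow> real \<Rightarrow> (nat \<Rightarrow> complex) \<Rightarrow> nat \<Rightarrow> complex" where
  "hilbert_op \<mu> \<alpha> \<beta> a n = (\<Sum>m. hilbert_term \<mu> \<alpha> \<beta> a n m)"

definition hilbert_bound ::
  "real measure \<Rightarrow> real \<Rightarrow> real \<Rightarrow> (nat \<Rightarrow> real) \<Rightarrow> (nat \<Rightarrow> real) \<Rightarrow> real \<Rightarrow> bool" where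
  "hilbert_bound \<mu> \<alpha> \<beta> w v C \<longleftrightarrow>
     (\<forall>a\<in>linf w. hilbert_op \<mu> \<alpha> \<beta> a \<in> linf v \<and>
        linf_norm v (hilbert_op \<mu> \<alpha> \<beta> a) \<le> C * linf_norm w a)"

definition hilbert_bounded ::
  "real measure \<Rightarrow> real \<Rightarrow> real \<Rightarrow> (nat \<Rightarrow> real) \<Rightarrow> (nat \<Rightarrow> real) \<Rightarrow> bool" where
  "hilbert_bounded \<mu> \<alpha> \<beta> w v \<longleftrightarrow>
     (\<forall>a\<in>linf w. \<forall>n. summable (hilbert_term \<mu> \<alpha> \<beta> a n)) \<and>
     (\<exists>C. hilbert_bound \<mu> \<alpha> \<beta> w v C)"

definition hilbert_norm ::
  "real measure \<Rightarrow> real \<Rightarrow> real \<Rightarrow> (nat \<Rightarrow> real) \<Rightarrow> (nat \<Rightarrow> real) \<Rightarrow> real" where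
  "hilbert_norm \<mu> \<alpha> \<beta> w v = (LEAST C. hilbert_bound \<mu> \<alpha> \<beta> w v C)"

definition weight1 :: "real \<Rightarrow> nat \<Rightarrow> real" where
  "weight1 \<alpha> m = inverse (real_pochhammer (real m + 1) \<alpha>)"

definition weight2 :: "real \<Rightarrow> real \<Rightarrow> nat \<Rightarrow> real" where
  "weight2 \<alpha> \<beta> m = inverse (real_pochhammer (real m + \<beta> - \<alpha> + 1) \<alpha>)"

definition C_infty :: "real measure \<Rightarrow> real \<Rightarrow> ennreal" where
  "C_infty \<mu> \<beta> = (\<integral>\<^sup>+ t. ennreal ((1 - t) powr (- \<beta> - 1)) \<partial>\<mu>)"

end

theory Submission
  imports Defs
begin

text \<open>
  Extremal sequence: for \<open>a m = 1 / weight1 \<alpha> m\<close> the negative binomial series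
  gives \<open>weight2 \<alpha> \<beta> n * hilbert_op \<mu> \<alpha> \<beta> a n = (\<integral>t. (1 - t) powr (- \<beta> - 1) \<partial>\<mu>)\<close> for every
  \<open>n\<close>, by monotone convergence. All other sequences in the unit ball are dominated termwise by
  this one.
\<close>

section \<open>Negative binomial series\<close>

text \<open>Newton's binomial series with exponent \<open>- c\<close> at \<open>- t\<close>: the
  signs of the coefficient and of the power cancel, leaving \<open>pochhammer c m / fact m\<close>,
  a quotient of Gamma values because \<open>c > 0\<close> is not a pole.\<close>

lemma negative_binomial_series:
  fixes c t :: real
  assumes "c > 0" "\<bar>t\<bar> < 1"
  shows "(\<lambda>m. Gamma (c + real m) / (fact m * Gamma c) * t ^ m) sums (1 - t) powr (- c)"
proof -
  have c: "c \<notin> \<int>\<^sub>\<le>\<^sub>0"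
    using assms(1) by (auto elim!: nonpos_Ints_cases)
  have "(- c gchoose m) * (- t) ^ m = Gamma (c + real m) / (fact m * Gamma c) * t ^ m" for m
  proof -
    have "(- c gchoose m) * (- t) ^ m = ((-1) ^ m * (-1) ^ m) * (pochhammer c m / fact m * t ^ m)"
      by (simp add: gbinomial_pochhammer power_minus[of t])
    also have "(-1) ^ m * (-1) ^ m = (1::real)"
      by (simp flip: power_add)
    finally show ?thesis
      using pochhammer_Gamma[OF c, of m] by (simp add: field_simps)
  qed
  then show ?thesis
    using gen_binomial_real[of "- t" "- c"] assms(2) by simp
qed

definition moment :: "real measure \<Rightarrow> nat \<Rightarrow> nat \<Rightarrow> real" where
  "moment \<mu> n m = (LINT t|\<mu>. t ^ m * (1 - t) ^ n)"

text \<open>The coefficient of \<open>t ^ m\<close> in the expansion of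
  \<open>(1 - t) powr (- (n + \<beta> + 1))\<close>. It is what remains of the operator's
  coefficient once both weights are absorbed, hence the absence of \<alpha>.\<close>

definition hilbert_kernel :: "real \<Rightarrow> nat \<Rightarrow> nat \<Rightarrow> real" where
  "hilbert_kernel \<beta> n m = Gamma (real n + \<beta> + 1 + real m) / (fact m * Gamma (real n + \<beta> + 1))"

lemma hilbert_kernel_nonneg: "\<beta> > -1 \<Longrightarrow> hilbert_kernel \<beta> n m \<ge> 0"
  by (auto simp: hilbert_kernel_def intro!: divide_nonneg_pos mult_pos_pos Gamma_real_pos less_imp_le)

text \<open>The negative binomial series with \<open>c = n + \<beta> + 1\<close>; the factor
  \<open>(1 - t) ^ n\<close> cancels the \<open>n\<close> in the exponent. This makes the sum, and
  later every row sum of the matrix, independent of \<open>n\<close>.\<close>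

lemma hilbert_kernel_sums:
  assumes "\<beta> > -1" "0 < t" "t < 1"
  shows "(\<lambda>m. hilbert_kernel \<beta> n m * (t ^ m * (1 - t) ^ n)) sums (1 - t) powr (- \<beta> - 1)"
proof -
  have "(\<lambda>m. hilbert_kernel \<beta> n m * t ^ m * (1 - t) ^ n) sums
      ((1 - t) powr (- (real n + \<beta> + 1)) * (1 - t) ^ n)"
    unfolding hilbert_kernel_def by (intro sums_mult2 negative_binomial_series) (use assms in auto)
  also have "(1 - t) powr (- (real n + \<beta> + 1)) * (1 - t) ^ n = (1 - t) powr (- \<beta> - 1)"
    using assms by (simp flip: powr_realpow powr_add)
  finally show ?thesis
    by (simp add: mult.assoc)
qed

lemma weighted_le_linf_norm:
  assumes "a \<in> linf w"
  shows "w m * cmod (a m) \<le> linf_norm w a"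
  using assms unfolding linf_def linf_norm_def by (auto intro: cSUP_upper)

section \<open>Moments of the measure and the constant \<open>C_infty\<close>\<close>

context
  fixes \<mu> :: "real measure"
  assumes fin: "finite_measure \<mu>"
    and sets: "sets \<mu> = sets (restrict_space borel {0<..<1})"
begin

lemma space_unit: "space \<mu> = {0<..<1}"
  using sets_eq_imp_space_eq[OF sets] by (simp add: space_restrict_space)

lemma measurable_unit:
  fixes f :: "real \<Rightarrow> real"
  assumes "f \<in> borel_measurable borel"
  shows "f \<in> borel_measurable \<mu>"
  using measurable_restrict_space1[OF assms, of "{0<..<1}"]
    measurable_cong_sets[OF sets refl, of borel] by metis

text \<open>The integrand is bounded by 1 on the unit interval and \<mu> is finite.\<close>

lemma integrable_moment: "integrable \<mu> (\<lambda>t. t ^ m * (1 - t) ^ n)"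
proof (rule finite_measure.integrable_const_bound[OF fin, of _ 1])
  show "AE t in \<mu>. norm (t ^ m * (1 - t) ^ n) \<le> 1"
    by (auto simp: space_unit abs_mult power_abs intro!: AE_I2 mult_le_one power_le_one)
qed (intro measurable_unit, measurable)

lemma moment_nonneg: "moment \<mu> n m \<ge> 0"
  unfolding moment_def by (rule integral_nonneg_AE) (auto simp: space_unit)

text \<open>Nonnegative terms allow sum and integral to be exchanged. Stating this in
  \<open>ennreal\<close> covers the case of an infinite value, on which the necessity direction
  rests.\<close>

lemma suminf_hilbert_kernel_moment:
  assumes "\<beta> > -1"
  shows "(\<Sum>m. ennreal (hilbert_kernel \<beta> n m * moment \<mu> n m)) = C_infty \<mu> \<beta>"
proof -
  have "ennreal (hilbert_kernel \<beta> n m * moment \<mu> n m)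
      = (\<integral>\<^sup>+ t. ennreal (hilbert_kernel \<beta> n m * (t ^ m * (1 - t) ^ n)) \<partial>\<mu>)" for m
  proof -
    have "hilbert_kernel \<beta> n m * moment \<mu> n m
        = (LINT t|\<mu>. hilbert_kernel \<beta> n m * (t ^ m * (1 - t) ^ n))"
      by (simp add: moment_def)
    then show ?thesis
      by (simp only:, intro nn_integral_eq_integral[symmetric])
        (auto simp: space_unit hilbert_kernel_nonneg assms intro!: integrable_moment AE_I2)
  qed
  then have "(\<Sum>m. ennreal (hilbert_kernel \<beta> n m * moment \<mu> n m))
      = (\<integral>\<^sup>+ t. (\<Sum>m. ennreal (hilbert_kernel \<beta> n m * (t ^ m * (1 - t) ^ n))) \<partial>\<mu>)"
    by (simp, intro nn_integral_suminf[symmetric] measurable_compose[OF _ measurable_ennreal]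
        measurable_unit) measurable
  also have "\<dots> = C_infty \<mu> \<beta>"
    unfolding C_infty_def
  proof (rule nn_integral_cong)
    fix t assume "t \<in> space \<mu>"
    then have t: "0 < t" "t < 1"
      by (auto simp: space_unit)
    show "(\<Sum>m. ennreal (hilbert_kernel \<beta> n m * (t ^ m * (1 - t) ^ n)))
        = ennreal ((1 - t) powr (- \<beta> - 1))"
      using hilbert_kernel_sums[OF assms t, of n] t
      by (intro suminf_ennreal_eq) (auto simp: hilbert_kernel_nonneg assms)
  qed
  finally show ?thesis .
qed

text \<open>A nonnegative real series converges exactly when its \<open>ennreal\<close> sum is
  finite. Since \<open>C_infty\<close> does not depend on \<open>n\<close>, convergence of a single
  row decides all of them.\<close>

lemma hilbert_kernel_moment_sums:
  assumes "\<beta> > -1"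
  shows "C_infty \<mu> \<beta> < \<infinity> \<longleftrightarrow> summable (\<lambda>m. hilbert_kernel \<beta> n m * moment \<mu> n m)"
    and "C_infty \<mu> \<beta> < \<infinity> \<Longrightarrow>
      (\<lambda>m. hilbert_kernel \<beta> n m * moment \<mu> n m) sums enn2real (C_infty \<mu> \<beta>)"
proof -
  let ?f = "\<lambda>m. hilbert_kernel \<beta> n m * moment \<mu> n m"
  have nonneg: "0 \<le> ?f m" for m
    using hilbert_kernel_nonneg[OF assms] moment_nonneg by simp
  \<comment> \<open>Conditional, because the real \<open>suminf\<close> represents the sum only for
    a convergent series.\<close>
  have eq: "C_infty \<mu> \<beta> = ennreal (suminf ?f)" if "summable ?f"
    unfolding suminf_hilbert_kernel_moment[OF assms, of n, symmetric]
    by (intro suminf_ennreal2 nonneg that)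
  show *: "C_infty \<mu> \<beta> < \<infinity> \<longleftrightarrow> summable ?f"
  proof
    assume "C_infty \<mu> \<beta> < \<infinity>"
    then show "summable ?f"
      using suminf_hilbert_kernel_moment[OF assms, of n] nonneg
      by (intro summable_suminf_not_top) auto
  next
    assume "summable ?f"
    then show "C_infty \<mu> \<beta> < \<infinity>"
      by (simp only: eq) simp
  qed
  assume "C_infty \<mu> \<beta> < \<infinity>"
  then have s: "summable ?f"
    using * by simp
  have "enn2real (C_infty \<mu> \<beta>) = suminf ?f"
    unfolding eq[OF s] by (intro enn2real_ennreal suminf_nonneg s nonneg)
  with s show "?f sums enn2real (C_infty \<mu> \<beta>)"
    by (simp only: summable_sums)
qed

section \<open>Rescaling by the weights and the upper bound\<close>

context
  fixes \<alpha> \<beta> :: real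
  assumes alpha: "\<alpha> > -1" and beta: "\<beta> > -1" and diff: "\<beta> - \<alpha> > -1"
begin

lemma weight1_pos: "weight1 \<alpha> m > 0"
  unfolding weight1_def real_pochhammer_def using alpha
  by (intro positive_imp_inverse_positive divide_pos_pos Gamma_real_pos) auto

lemma weight2_pos: "weight2 \<alpha> \<beta> m > 0"
  unfolding weight2_def real_pochhammer_def using beta diff
  by (intro positive_imp_inverse_positive divide_pos_pos Gamma_real_pos) auto

text \<open>Here \<open>weight2 \<alpha> \<beta> n\<close> is
  \<open>Gamma (n + \<beta> - \<alpha> + 1) / Gamma (n + \<beta> + 1)\<close> and
  \<open>weight1 \<alpha> m\<close> is \<open>fact m / Gamma (m + \<alpha> + 1)\<close>. Rescaling
  thus reduces the operator to a nonnegative matrix acting on unweighted bounded sequences.\<close>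

lemma hilbert_term_weighted:
  "of_real (weight2 \<alpha> \<beta> n) * hilbert_term \<mu> \<alpha> \<beta> a n m
    = of_real (hilbert_kernel \<beta> n m * moment \<mu> n m) * (of_real (weight1 \<alpha> m) * a m)"
proof -
  let ?c = "Gamma (real n + real m + \<beta> + 1) /
           (Gamma (real m + \<alpha> + 1) * Gamma (real n + \<beta> - \<alpha> + 1))"
  have "hilbert_term \<mu> \<alpha> \<beta> a n m
      = (LINT t|\<mu>. complex_of_real (?c * (t ^ m * (1 - t) ^ n))) * a m"
    unfolding hilbert_term_def mult.assoc
    by (simp only: integral_mult_left_zero flip: mult.assoc)
  also have "(LINT t|\<mu>. complex_of_real (?c * (t ^ m * (1 - t) ^ n))) = of_real (?c * moment \<mu> n m)"
    unfolding integral_complex_of_real moment_def by simp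
  finally have eq: "of_real (weight2 \<alpha> \<beta> n) * hilbert_term \<mu> \<alpha> \<beta> a n m
      = of_real (weight2 \<alpha> \<beta> n * ?c * moment \<mu> n m) * a m"
    by simp
  have "weight2 \<alpha> \<beta> n * ?c = hilbert_kernel \<beta> n m * weight1 \<alpha> m"
  proof -
    have "Gamma (real n + \<beta> - \<alpha> + 1) > 0" "Gamma (real n + \<beta> + 1) > 0" "Gamma (real m + \<alpha> + 1) > 0"
      using alpha beta diff by (auto intro!: Gamma_real_pos)
    \<comment> \<open>Cancels the numerator of \<open>weight1\<close> against the
      \<open>fact m\<close> in \<open>hilbert_kernel\<close>.\<close>
    moreover have "Gamma (real m + 1) = fact m"
      by (simp add: Gamma_fact add.commute)
    ultimately show ?thesis
      unfolding weight1_def weight2_def real_pochhammer_def hilbert_kernel_def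
      by (simp add: field_simps)
  qed
  then show ?thesis
    unfolding eq by (simp only: of_real_mult mult_ac)
qed

text \<open>Each rescaled term is at most its matrix entry times the norm of \<open>a\<close>, and
  every row of the matrix sums to \<open>C_infty\<close>. Comparison gives convergence and the bound
  together.\<close>

lemma hilbert_bounds:
  assumes C: "C_infty \<mu> \<beta> < \<infinity>" and a: "a \<in> linf (weight1 \<alpha>)"
  shows "summable (hilbert_term \<mu> \<alpha> \<beta> a n)"
    and "weight2 \<alpha> \<beta> n * cmod (hilbert_op \<mu> \<alpha> \<beta> a n)
          \<le> enn2real (C_infty \<mu> \<beta>) * linf_norm (weight1 \<alpha>) a"
proof -
  let ?w = "of_real (weight2 \<alpha> \<beta> n) :: complex" and ?h = "hilbert_term \<mu> \<alpha> \<beta> a n"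
  let ?g = "\<lambda>m. hilbert_kernel \<beta> n m * moment \<mu> n m * linf_norm (weight1 \<alpha>) a"
  have g: "?g sums (enn2real (C_infty \<mu> \<beta>) * linf_norm (weight1 \<alpha>) a)"
    by (intro sums_mult2 hilbert_kernel_moment_sums(2) beta C)
  have le: "cmod (?w * ?h m) \<le> ?g m" for m
    unfolding hilbert_term_weighted norm_mult norm_of_real
    using weighted_le_linf_norm[OF a, of m] weight1_pos[of m] hilbert_kernel_nonneg[OF beta] moment_nonneg
    by (auto simp: abs_mult intro!: mult_left_mono)
  have "summable (\<lambda>m. ?w * ?h m)"
    using summable_comparison_test'[OF sums_summable[OF g] le] .
  \<comment> \<open>The nonzero constant factor \<open>?w\<close> can be divided out.\<close>
  then show s: "summable ?h"
    using weight2_pos[of n] by simp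
  have "weight2 \<alpha> \<beta> n * cmod (hilbert_op \<mu> \<alpha> \<beta> a n) = cmod (\<Sum>m. ?w * ?h m)"
    using weight2_pos[of n] s by (simp add: hilbert_op_def norm_mult suminf_mult)
  also have "\<dots> \<le> (\<Sum>m. ?g m)"
    by (rule norm_suminf_le[OF le sums_summable[OF g]])
  finally show "weight2 \<alpha> \<beta> n * cmod (hilbert_op \<mu> \<alpha> \<beta> a n)
      \<le> enn2real (C_infty \<mu> \<beta>) * linf_norm (weight1 \<alpha>) a"
    using g by (simp add: sums_iff)
qed

text \<open>The row estimate is uniform in \<open>n\<close>, so it yields both membership in the
  target space and the bound on the supremum.\<close>

lemma hilbert_bound_C_infty:
  assumes "C_infty \<mu> \<beta> < \<infinity>"
  shows "hilbert_bound \<mu> \<alpha> \<beta> (weight1 \<alpha>) (weight2 \<alpha> \<beta>) (enn2real (C_infty \<mu> \<beta>))"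
  using hilbert_bounds(2)[OF assms]
  by (fastforce simp: hilbert_bound_def linf_def linf_norm_def bdd_above_def intro!: cSUP_least)

section \<open>The extremal sequence and the exact norm\<close>

definition extremal :: "nat \<Rightarrow> complex" where
  "extremal m = of_real (inverse (weight1 \<alpha> m))"

lemma weight1_extremal: "weight1 \<alpha> m * cmod (extremal m) = 1"
  using weight1_pos[of m] by (simp add: extremal_def norm_inverse)

lemma extremal_in_linf: "extremal \<in> linf (weight1 \<alpha>)"
  by (simp add: linf_def weight1_extremal)

lemma linf_norm_extremal: "linf_norm (weight1 \<alpha>) extremal = 1"
  by (simp add: linf_norm_def weight1_extremal)

text \<open>The weights cancel and leave the bare matrix entries; as these are nonnegative reals,
  taking moduli loses nothing.\<close>

lemma hilbert_term_extremal:
  "of_real (weight2 \<alpha> \<beta> n) * hilbert_term \<mu> \<alpha> \<beta> extremal n m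
    = of_real (hilbert_kernel \<beta> n m * moment \<mu> n m)"
  unfolding hilbert_term_weighted using weight1_pos[of m] by (simp add: extremal_def)

text \<open>At row 0 the rescaled series of \<open>extremal\<close> is the row sum of the matrix,
  whose convergence is equivalent to finiteness of \<open>C_infty\<close>.\<close>

lemma C_infty_finite_if_bounded:
  assumes "hilbert_bounded \<mu> \<alpha> \<beta> (weight1 \<alpha>) (weight2 \<alpha> \<beta>)"
  shows "C_infty \<mu> \<beta> < \<infinity>"
proof -
  have "summable (\<lambda>m. of_real (weight2 \<alpha> \<beta> 0) * hilbert_term \<mu> \<alpha> \<beta> extremal 0 m)"
    using assms extremal_in_linf by (auto simp: hilbert_bounded_def intro!: summable_mult)
  then show ?thesis
    unfolding hilbert_term_extremal summable_of_real_iff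
    using hilbert_kernel_moment_sums(1)[OF beta] by blast
qed

lemma hilbert_op_extremal:
  assumes "C_infty \<mu> \<beta> < \<infinity>"
  shows "weight2 \<alpha> \<beta> n * cmod (hilbert_op \<mu> \<alpha> \<beta> extremal n) = enn2real (C_infty \<mu> \<beta>)"
proof -
  have "of_real (weight2 \<alpha> \<beta> n) * hilbert_op \<mu> \<alpha> \<beta> extremal n
      = (\<Sum>m. of_real (hilbert_kernel \<beta> n m * moment \<mu> n m))"
    unfolding hilbert_op_def hilbert_term_extremal[symmetric]
    by (rule suminf_mult[symmetric]) (rule hilbert_bounds(1)[OF assms extremal_in_linf])
  also have "\<dots> = of_real (enn2real (C_infty \<mu> \<beta>))"
    by (intro sums_unique[symmetric] sums_of_real hilbert_kernel_moment_sums(2) beta assms)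
  finally have "cmod (of_real (weight2 \<alpha> \<beta> n) * hilbert_op \<mu> \<alpha> \<beta> extremal n)
      = enn2real (C_infty \<mu> \<beta>)"
    by simp
  then show ?thesis
    using weight2_pos[of n] by (simp add: norm_mult)
qed

lemma hilbert_bounded_iff:
  "hilbert_bounded \<mu> \<alpha> \<beta> (weight1 \<alpha>) (weight2 \<alpha> \<beta>) \<longleftrightarrow> C_infty \<mu> \<beta> < \<infinity>"
  using C_infty_finite_if_bounded hilbert_bounds(1) hilbert_bound_C_infty
  by (auto simp: hilbert_bounded_def)

lemma hilbert_norm_eq:
  assumes "C_infty \<mu> \<beta> < \<infinity>"
  shows "hilbert_norm \<mu> \<alpha> \<beta> (weight1 \<alpha>) (weight2 \<alpha> \<beta>) = enn2real (C_infty \<mu> \<beta>)"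
  unfolding hilbert_norm_def
\<comment> \<open>The least constant exists: \<open>extremal\<close> has norm 1 and forces every
  admissible \<open>C\<close> to be at least \<open>C_infty\<close>, which is itself
  admissible.\<close>
proof (rule Least_equality)
  fix C assume "hilbert_bound \<mu> \<alpha> \<beta> (weight1 \<alpha>) (weight2 \<alpha> \<beta>) C"
  then have "linf_norm (weight2 \<alpha> \<beta>) (hilbert_op \<mu> \<alpha> \<beta> extremal) \<le> C"
    using extremal_in_linf linf_norm_extremal by (auto simp: hilbert_bound_def)
  then show "enn2real (C_infty \<mu> \<beta>) \<le> C"
    \<comment> \<open>The weighted image of \<open>extremal\<close> has the same modulus at every
      \<open>n\<close>, so the supremum is over a constant function.\<close>
    by (simp add: linf_norm_def hilbert_op_extremal[OF assms])
qed (rule hilbert_bound_C_infty[OF assms])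

end

end

theorem theorem1p4:
  fixes \<mu> :: "real measure" and \<alpha> \<beta> :: real
  assumes "finite_measure \<mu>"
    and "sets \<mu> = sets (restrict_space borel {0<..<1})"
    and "\<alpha> > -1" and "\<beta> > -1" and "\<beta> - \<alpha> > -1"
  shows "(hilbert_bounded \<mu> \<alpha> \<beta> (weight1 \<alpha>) (weight2 \<alpha> \<beta>) \<longleftrightarrow> C_infty \<mu> \<beta> < \<infinity>) \<and>
         (hilbert_bounded \<mu> \<alpha> \<beta> (weight1 \<alpha>) (weight2 \<alpha> \<beta>) \<longrightarrow>
            hilbert_norm \<mu> \<alpha> \<beta> (weight1 \<alpha>) (weight2 \<alpha> \<beta>) = enn2real (C_infty \<mu> \<beta>))"
  using hilbert_bounded_iff[OF assms] hilbert_norm_eq[OF assms] by blast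

end
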